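(* Let $p$ be a prime, let $G$ be a finite $p$-group and let $A \le \mathrm{Aut}(G)$. Let $\mathcal{C}$ be the set of all minimal subgroups of $G$, that is, the set of subgroups of $G$ of order $p$, and let $\mathcal{C}_0$ be a complete set of representatives of the $A$-orbits on $\mathcal{C}$. Then there exists a one-to-one correspondence between the connected components of $\Delta(G,A)$ and $\mathcal{C}_0$. Furthermore, for every $1 \neq x \in G$ with $\langle x \rangle \in \mathcal{C}_0$, the vertex $x^A$ is adjacent to all of the other vertices in its connected component of $\Delta(G,A)$.
   Context: For a finite group $G$ and a subgroup $A \le \mathrm{Aut}(G)$, write $g^A = \{g^a \mid a \in A\}$ for the $A$-orbit of $g \in G$. The automorphic cyclic graph $\Delta(G,A)$ is the simple graph with vertex set $\{g^A : 1 \ne g \in G\}$, in which two distinct vertices $x^A, y^A$ are joined by an edge if there exist $x' \in x^A$ and $y' \in y^A$ such that $\langle x', y' \rangle$ is cyclic. The group $A$ acts on the set of subgroups of $G$ by $H \mapsto H^a$. *)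

theory Defs
  imports
    "HOL-Computational_Algebra.Primes"
    "HOL-Algebra.Bij"
    "HOL-Algebra.Group_Action"
    "HOL-Algebra.Elementary_Groups"
    "Graph_Theory.Digraph_Component"
begin

(* A subgroup A of Aut(G) acts on elements by evaluation and on subgroups by taking images.
   Maps are composed from right to left in AutoGroup; orbits do not depend on whether the
   action is written on the left or, as g^a, on the right. *)

definition element_orbit ::
    "('a, 'b) monoid_scheme \<Rightarrow> ('a \<Rightarrow> 'a) set \<Rightarrow> 'a \<Rightarrow> 'a set" where
  "element_orbit G A g = Group_Action.orbit (AutoGroup G\<lparr>carrier := A\<rparr>) (\<lambda>a. a) g"

definition minimal_subgroups :: "('a, 'b) monoid_scheme \<Rightarrow> nat \<Rightarrow> 'a set set" where
  "minimal_subgroups G p = {H. subgroup H G \<and> card H = p}"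

definition orbit_representatives ::
    "('a, 'b) monoid_scheme \<Rightarrow> ('a \<Rightarrow> 'a) set \<Rightarrow> 'a set set \<Rightarrow> 'a set set \<Rightarrow> bool" where
  "orbit_representatives G A C C0 \<longleftrightarrow>
     C0 \<subseteq> C \<and>
     (\<forall>X \<in> Group_Action.orbits (AutoGroup G\<lparr>carrier := A\<rparr>) C (\<lambda>a H. a ` H). \<exists>!H. H \<in> X \<inter> C0)"

(* An undirected edge is represented by the two opposite arcs. *)
definition aut_cyclic_graph ::
    "('a, 'b) monoid_scheme \<Rightarrow> ('a \<Rightarrow> 'a) set \<Rightarrow> 'a set pair_pre_digraph" where
  "aut_cyclic_graph G A =
     \<lparr> pverts = {element_orbit G A g | g. g \<in> carrier G \<and> g \<noteq> \<one>\<^bsub>G\<^esub>},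
       parcs = {(element_orbit G A x, element_orbit G A y) | x y.
         x \<in> carrier G \<and> x \<noteq> \<one>\<^bsub>G\<^esub> \<and> y \<in> carrier G \<and> y \<noteq> \<one>\<^bsub>G\<^esub> \<and>
         element_orbit G A x \<noteq> element_orbit G A y \<and>
         (\<exists>x' \<in> element_orbit G A x. \<exists>y' \<in> element_orbit G A y.
            cyclic_group (subgroup_generated G {x', y'}))} \<rparr>"

definition connected_components :: "'v pair_pre_digraph \<Rightarrow> ('v, 'v \<times> 'v) pre_digraph set" where
  "connected_components D =
     {K. pre_digraph.max_subgraph (with_proj D) Digraph_Component.connected K}"

lemma pair_graph_aut_cyclic_graph:
  assumes "finite (carrier G)"
  shows "pair_graph (aut_cyclic_graph G A)"
proof -
  let ?D = "aut_cyclic_graph G A"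
  have V: "finite (pverts ?D)"
    using assms by (simp add: aut_cyclic_graph_def)
  have E: "parcs ?D \<subseteq> pverts ?D \<times> pverts ?D"
    by (auto simp: aut_cyclic_graph_def)
  have S: "sym (parcs ?D)"
    by (rule symI) (fastforce simp: aut_cyclic_graph_def insert_commute)
  have L: "fst e \<noteq> snd e" if "e \<in> parcs ?D" for e
    using that by (auto simp: aut_cyclic_graph_def)
  show ?thesis
  proof
    show "finite (parcs ?D)"
      using V E by (meson finite_SigmaI finite_subset)
    show "symmetric (with_proj ?D)"
      using S by (simp add: symmetric_def)
  qed (use V E L in auto)
qed

lemma strongly_connected_imp_connected:
  assumes "strongly_connected H"
  shows "Digraph_Component.connected H"
proof -
  have "arcs_ends H \<subseteq> (arcs_ends H)\<^sup>s"
    by (auto simp: symcl_def)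
  with assms show ?thesis
    unfolding connected_conv strongly_connected_def reachable_def
    by (meson rtrancl_on_mono subset_refl)
qed

lemma connected_components_eq_sccs:
  assumes "pair_graph D"
  shows "connected_components D = pre_digraph.sccs (with_proj D)"
proof -
  interpret pair_graph D by fact
  have ind: "induced_subgraph (with_proj D \<restriction> verts H) (with_proj D)"
    if "subgraph H (with_proj D)" for H
    using subgraph_imp_subverts[OF that] by (intro induced_induce) simp
  have strong: "strongly_connected (with_proj D \<restriction> verts H)"
    if H: "subgraph H (with_proj D)" "Digraph_Component.connected H" for H
  proof -
    interpret I: wf_digraph "with_proj D \<restriction> verts H"
      using ind[OF H(1)] by (rule wf_digraphI_induced)
    have "spanning H (with_proj D \<restriction> verts H)"
      using subgraph_induce_subgraphI2[OF H(1)] by (simp add: spanning_def)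
    then have "Digraph_Component.connected (with_proj D \<restriction> verts H)"
      using H(2) by (rule I.connected_spanning_imp_connected)
    moreover have "symmetric (with_proj D \<restriction> verts H)"
      using pair_sym_arcs ind[OF H(1)] by (rule induced_graph_imp_symmetric)
    ultimately show ?thesis
      by (intro I.symmetric_connected_imp_strongly_connected)
  qed
  have sub: "subgraph H (with_proj D \<restriction> verts H)" "subgraph (with_proj D \<restriction> verts H) (with_proj D)"
    if "subgraph H (with_proj D)" for H
    using that ind[OF that] by (auto intro: subgraph_induce_subgraphI2 induced_imp_subgraph)
  have "max_subgraph Digraph_Component.connected K \<longleftrightarrow> max_subgraph strongly_connected K" for K
  proof
    assume K: "max_subgraph Digraph_Component.connected K"
    then have "subgraph K (with_proj D)" "Digraph_Component.connected K"
      by (auto simp: max_subgraph_def)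
    note sc = strong[OF this] and sb = sub[OF this(1)]
    have "with_proj D \<restriction> verts K = K"
      using K sb strongly_connected_imp_connected[OF sc] by (auto simp: max_subgraph_def)
    with sc have "strongly_connected K" by simp
    with K show "max_subgraph strongly_connected K"
      using max_subgraph_mp strongly_connected_imp_connected by blast
  next
    assume K: "max_subgraph strongly_connected K"
    show "max_subgraph Digraph_Component.connected K"
    proof (rule max_subgraphI)
      show "Digraph_Component.connected K"
        using K strongly_connected_imp_connected by (auto simp: max_subgraph_def)
      show "subgraph K (with_proj D)"
        using K by (auto simp: max_subgraph_def)
      fix H assume H: "K \<noteq> H" "subgraph K H" "subgraph H (with_proj D)"
      show "\<not> Digraph_Component.connected H"
      proof
        assume "Digraph_Component.connected H"
        note sc = strong[OF H(3) this] and sb = sub[OF H(3)]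
        have "subgraph K (with_proj D \<restriction> verts H)"
          using H(2) sb(1) by (rule subgraph_trans)
        with K sc sb have "with_proj D \<restriction> verts H = K"
          by (auto simp: max_subgraph_def)
        with sb(1) H(2) have "H = K"
          by (auto simp: subgraph_def compatible_def)
        with H(1) show False by simp
      qed
    qed
  qed
  then show ?thesis
    by (simp add: connected_components_def sccs_altdef2)
qed

lemma ex1_connected_component:
  assumes "pair_graph D" and "v \<in> pverts D"
  shows "\<exists>!K. K \<in> connected_components D \<and> v \<in> verts K"
proof -
  interpret pair_graph D by fact
  have "(with_proj D \<restriction> {w. v \<rightarrow>\<^sup>*\<^bsub>with_proj D\<^esub> w}) \<in> sccs"
    using assms(2) induce_reachable_is_in_sccs by simp
  moreover have "v \<in> verts (with_proj D \<restriction> {w. v \<rightarrow>\<^sup>*\<^bsub>with_proj D\<^esub> w})"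
    using assms(2) by simp
  moreover have "K = K'" if "K \<in> sccs" "K' \<in> sccs" "v \<in> verts K" "v \<in> verts K'" for K K'
    using that scc_disj[of K K'] by auto
  ultimately show ?thesis
    unfolding connected_components_eq_sccs[OF assms(1)] by blast
qed

end

(* Every nontrivial element g of a finite p-group has a unique subgroup of order p below the
   cyclic group it generates.  Up to the action of A this subgroup is the same at both ends of an
   edge, because a cyclic group has at most one subgroup of order p.  Conversely, if it is
   generated by x, then x lies in the cyclic group generated by g, so the orbit of x is adjacent to
   (or equal to) the orbit of g. *)

theory Submission
  imports Defs "HOL-Algebra.Multiplicative_Group"
begin

section \<open>Subgroups of finite cyclic groups\<close>

lemma (in group) card_subgroup_dvd:
  assumes "subgroup H G" "subgroup K G" "H \<subseteq> K"
  shows "card H dvd card K"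
proof -
  interpret K: group "G\<lparr>carrier := K\<rparr>"
    using assms(2) by (rule subgroup_imp_group)
  have "card (rcosets\<^bsub>G\<lparr>carrier := K\<rparr>\<^esub> H) * card H = card K"
    using K.lagrange[OF subgroup_incl[OF assms]] by (simp add: order_def)
  then show ?thesis
    by (rule dvdI[OF trans[OF sym mult.commute]])
qed

text \<open>By Lagrange both subgroups consist of solutions of \<open>u [^] m = \<one>\<close> in
  the cyclic group. There are at most m such solutions, so each subgroup is the full solution
  set.\<close>

lemma (in group) subgroup_card_eq_if_subset_cyclic:
  assumes z: "z \<in> carrier G" and ord: "ord z > 0"
    and H: "subgroup H G" "card H = m" "H \<subseteq> generate G {z}"
    and K: "subgroup K G" "card K = m" "K \<subseteq> generate G {z}"
    and m: "m > 0"
  shows "H = K"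
proof -
  let ?n = "ord z"
  let ?T = "{u \<in> generate G {z}. u [^] m = \<one>}"
  have gen: "generate G {z} = {z [^] k |k. k \<in> (UNIV :: nat set)}"
    using generate_pow_nat[OF z] ord by simp
  have fin: "finite (generate G {z})"
    using generate_pow_card[OF z] ord by (metis card.infinite less_irrefl)
  have sub: "L \<subseteq> ?T \<and> m dvd ?n"
    if L: "subgroup L G" "card L = m" "L \<subseteq> generate G {z}" for L
  proof
    interpret L: group "G\<lparr>carrier := L\<rparr>"
      using L(1) by (rule subgroup_imp_group)
    show "L \<subseteq> ?T"
    proof
      fix u assume u: "u \<in> L"
      have "u [^]\<^bsub>G\<lparr>carrier := L\<rparr>\<^esub> order (G\<lparr>carrier := L\<rparr>) = \<one>\<^bsub>G\<lparr>carrier := L\<rparr>\<^esub>"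
        by (rule L.pow_order_eq_1) (simp add: u)
      then have "u [^] m = \<one>"
        using L(2) by (simp add: order_def nat_pow_consistent[symmetric])
      then show "u \<in> ?T"
        using u L(3) by auto
    qed
    have "card L dvd card (generate G {z})"
      using L z by (intro card_subgroup_dvd generate_is_subgroup) auto
    then show "m dvd ?n"
      using L(2) generate_pow_card[OF z] by simp
  qed
  obtain q where q: "?n = m * q"
    using sub[OF H] by (auto elim: dvdE)
  have "q > 0"
    using q ord by (cases q) auto
  have "?T \<subseteq> (\<lambda>j. z [^] (q * j)) ` {..<m}"
  proof
    fix u assume "u \<in> ?T"
    then obtain k :: nat where k: "u = z [^] k" and "u [^] m = \<one>"
      using gen by blast
    then have "z [^] (k * m) = \<one>"
      using z by (simp add: nat_pow_pow)
    \<comment> \<open>The order of z is \<open>m * q\<close>, so a power of z solves the equation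
      only if its exponent is a multiple of q.\<close>
    then have "m * q dvd k * m"
      using pow_eq_id[OF z] q by simp
    then have "q dvd k"
      using m by (simp add: mult.commute)
    then obtain j where j: "k = q * j" by (auto elim: dvdE)
    \<comment> \<open>Reducing the exponent modulo the order leaves \<open>q * (j mod m)\<close>,
      which takes at most m values; this bounds the number of solutions.\<close>
    have "u = z [^] (k mod ?n + ?n * (k div ?n))"
      using k by simp
    also have "\<dots> = z [^] (k mod ?n) \<otimes> (z [^] ?n) [^] (k div ?n)"
      using z by (simp only: nat_pow_mult nat_pow_pow)
    also have "\<dots> = z [^] (k mod ?n)"
      using z by (simp add: pow_ord_eq_1)
    also have "k mod ?n = q * (j mod m)"
      by (simp add: j q mult.commute[of m q] mod_mult_mult1)
    finally show "u \<in> (\<lambda>j. z [^] (q * j)) ` {..<m}"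
      using m by auto
  qed
  then have "card ?T \<le> m"
    using surj_card_le[of "{..<m}"] by simp
  moreover have "finite ?T"
    using fin by simp
  ultimately have "L = ?T" if "L \<subseteq> ?T" "card L = m" for L
    using that card_seteq[of ?T L] by simp
  then show ?thesis
    using sub[OF H] sub[OF K] H(2) K(2) by blast
qed

text \<open>The witness is g raised to \<open>ord g div p\<close>: raising to a divisor of the order
  divides the order by it.\<close>

lemma (in group) ex_prime_subgroup_of_cyclic:
  assumes g: "g \<in> carrier G" and p: "prime p" and dvd: "p dvd ord g" "ord g > 0"
  shows "\<exists>m \<in> generate G {g}. ord m = p"
proof
  let ?k = "ord g div p"
  have k: "ord g = p * ?k"
    using dvd by simp
  then have "?k > 0"
    using dvd(2) by (cases ?k) simp_all
  then show "ord (g [^] ?k) = p"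
    using ord_pow[OF g, of ?k] k p by (metis dvd_triv_right nonzero_mult_div_cancel_right less_irrefl)
  show "g [^] ?k \<in> generate G {g}"
    using generate_pow_nat[OF g] dvd(2) by auto
qed

text \<open>Integer powers in the generated subgroup agree with those in G, so a generator there
  also spans inside G. This turns the edge condition into membership in a common
  \<open>generate G {z}\<close>.\<close>

lemma (in group) cyclic_subgroup_generated_pairD:
  assumes "cyclic_group (subgroup_generated G {x, y})" "x \<in> carrier G" "y \<in> carrier G"
  shows "\<exists>z \<in> carrier G. x \<in> generate G {z} \<and> y \<in> generate G {z}"
proof -
  let ?S = "subgroup_generated G {x, y}"
  obtain z where z: "z \<in> carrier ?S" "carrier ?S = range (\<lambda>n::int. z [^]\<^bsub>?S\<^esub> n)"
    using assms(1) group.cyclic_group[OF group_subgroup_generated] by blast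
  have zG: "z \<in> carrier G"
    using z(1) carrier_subgroup_generated_subset by blast
  have "carrier ?S = range (\<lambda>n::int. z [^] n)"
    using z(2) by (simp only: int_pow_subgroup_generated[OF z(1)])
  then have "carrier ?S = generate G {z}"
    unfolding generate_pow[OF zG] by blast
  moreover have "x \<in> carrier ?S" "y \<in> carrier ?S"
    using assms(2,3) by (auto simp: carrier_subgroup_generated intro: generate.incl)
  ultimately show ?thesis
    using zG by blast
qed

text \<open>Adding x to the generating set changes nothing, since x already lies in the span of y.
  This is how edges are produced.\<close>

lemma (in group) cyclic_subgroup_generated_pairI:
  assumes y: "y \<in> carrier G" and x: "x \<in> generate G {y}"
  shows "cyclic_group (subgroup_generated G {x, y})"
proof -
  have xG: "x \<in> carrier G"
    using generate_in_carrier[of "{y}"] x y by simp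
  have "generate G {x, y} \<subseteq> generate G {y}"
    using x y by (intro generate_subgroup_incl generate_is_subgroup) (auto intro: generate.incl)
  then have "generate G {x, y} = generate G {y}"
    using mono_generate[of "{y}" "{x, y}"] by auto
  then have "subgroup_generated G {x, y} = subgroup_generated G {y}"
    using xG y by (simp add: subgroup_generated_def Int_absorb1)
  then show ?thesis
    using cyclic_group_generated by simp
qed

text \<open>Any nontrivial element of H serves as z: the size of its span divides p and is not
  1.\<close>

lemma (in group) generate_singleton_if_prime_card:
  assumes p: "prime p" and H: "subgroup H G" "card H = p"
  shows "\<exists>z \<in> carrier G. z \<noteq> \<one> \<and> H = generate G {z}"
proof -
  have fin: "finite H"
    using H(2) p by (metis card.infinite not_prime_0)
  have "\<not> H \<subseteq> {\<one>}"
    using H(2) p prime_gt_1_nat[OF p] card_mono[of "{\<one>}" H] by auto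
  then obtain z where z: "z \<in> H" "z \<noteq> \<one>" by blast
  then have zG: "z \<in> carrier G"
    using subgroup.subset[OF H(1)] by blast
  have gen: "generate G {z} \<subseteq> H" "subgroup (generate G {z}) G"
    using z H(1) zG by (simp_all add: generate_subgroup_incl generate_is_subgroup)
  have "card (generate G {z}) dvd p"
    using card_subgroup_dvd[OF gen(2) H(1) gen(1)] H(2) by simp
  moreover have "card (generate G {z}) \<noteq> 1"
    using z(2) zG generate_pow_card ord_eq_1 by metis
  ultimately have "card (generate G {z}) = card H"
    using p H(2) by (auto simp: prime_nat_iff)
  then show ?thesis
    using zG z(2) gen(1) fin by (metis card_subset_eq)
qed

section \<open>Connected components from a vertex invariant\<close>

text \<open>The hypotheses say that the nonempty fibres of h on the vertices are exactly the vertex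
  sets of the components. A component is sent to the single value of h on it, which
  \<open>the_elem\<close> extracts. The second conclusion, constancy on components, is used
  separately for the adjacency claim.\<close>

lemma bij_betw_connected_components:
  assumes D: "pair_graph D"
    and arc: "\<And>u v. (u, v) \<in> parcs D \<Longrightarrow> h u = h v"
    and conn: "\<And>u v. u \<in> pverts D \<Longrightarrow> v \<in> pverts D \<Longrightarrow> h u = h v \<Longrightarrow> u \<rightarrow>\<^sup>*\<^bsub>with_proj D\<^esub> v"
  shows "bij_betw (\<lambda>K. the_elem (h ` verts K)) (connected_components D) (h ` pverts D)"
    and "K \<in> connected_components D \<Longrightarrow> u \<in> verts K \<Longrightarrow> v \<in> verts K \<Longrightarrow> h u = h v"
proof -
  interpret pair_graph D by fact
  let ?h = "\<lambda>K. the_elem (h ` verts K)"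
  have inv: "h u = h v" if "u \<rightarrow>\<^sup>*\<^bsub>with_proj D\<^esub> v" for u v
    using that
  proof (induction rule: reachable_induct)
    case (step x y)
    then show ?case using arc[of x y] by (simp add: arcs_ends_def arc_to_ends_def)
  qed simp
  \<comment> \<open>Arcs come in opposite pairs, so connected components coincide with strong
    components, and their vertex sets are the classes of mutual reachability.\<close>
  have comp: "verts K \<noteq> {}" "verts K \<subseteq> pverts D"
    "\<And>u v. u \<in> verts K \<Longrightarrow> v \<in> verts K \<Longrightarrow> u \<rightarrow>\<^sup>*\<^bsub>with_proj D\<^esub> v"
    "\<And>u v. u \<in> verts K \<Longrightarrow> u \<rightarrow>\<^sup>*\<^bsub>with_proj D\<^esub> v \<Longrightarrow> v \<rightarrow>\<^sup>*\<^bsub>with_proj D\<^esub> u \<Longrightarrow> v \<in> verts K"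
    if "K \<in> connected_components D" for K
  proof -
    have "verts K \<in> sccs_verts"
      using that connected_components_eq_sccs[OF D] in_sccs_vertsI_sccs by blast
    note K = this[unfolded in_sccs_verts_conv_reachable]
    show "verts K \<subseteq> pverts D"
      using sccs_verts_subsets[OF \<open>verts K \<in> sccs_verts\<close>] by simp
    show "verts K \<noteq> {}"
      "\<And>u v. u \<in> verts K \<Longrightarrow> v \<in> verts K \<Longrightarrow> u \<rightarrow>\<^sup>*\<^bsub>with_proj D\<^esub> v"
      "\<And>u v. u \<in> verts K \<Longrightarrow> u \<rightarrow>\<^sup>*\<^bsub>with_proj D\<^esub> v \<Longrightarrow> v \<rightarrow>\<^sup>*\<^bsub>with_proj D\<^esub> u \<Longrightarrow> v \<in> verts K"
      using K by blast+
  qed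
  have const: "h u = h v" if "K \<in> connected_components D" "u \<in> verts K" "v \<in> verts K" for K u v
    using inv comp(3)[OF that] by blast
  show "h u = h v" if "K \<in> connected_components D" "u \<in> verts K" "v \<in> verts K"
    using const that by blast
  have val: "?h K = h u" if "K \<in> connected_components D" "u \<in> verts K" for K u
  proof -
    have "h ` verts K = {h u}"
      using const[OF that(1)] that(2) by blast
    then show ?thesis by simp
  qed
  show "bij_betw ?h (connected_components D) (h ` pverts D)"
  proof (rule bij_betw_imageI)
    show "inj_on ?h (connected_components D)"
    proof (rule inj_onI)
      fix K K' assume K: "K \<in> connected_components D" "K' \<in> connected_components D" "?h K = ?h K'"
      obtain u v where uv: "u \<in> verts K" "v \<in> verts K'"
        using comp(1) K by blast
      then have "h u = h v"
        using K val by metis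
      moreover have V: "u \<in> pverts D" "v \<in> pverts D"
        using uv K comp(2) by blast+
      \<comment> \<open>Equal values of h give reachability in both directions, hence v lies in both
        components, and a vertex lies in only one.\<close>
      ultimately have "v \<in> verts K"
        using comp(4)[OF K(1) uv(1)] conn by metis
      then show "K = K'"
        using ex1_connected_component[OF D V(2)] K uv by blast
    qed
    show "?h ` connected_components D = h ` pverts D"
    proof
      show "?h ` connected_components D \<subseteq> h ` pverts D"
        using comp(1,2) val by blast
      show "h ` pverts D \<subseteq> ?h ` connected_components D"
      proof
        fix w assume "w \<in> h ` pverts D"
        then obtain v where v: "w = h v" "v \<in> pverts D" by blast
        then obtain K where "K \<in> connected_components D" "v \<in> verts K"
          using ex1_connected_component[OF D] by blast
        then show "w \<in> ?h ` connected_components D"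
          using v val by (metis imageI)
      qed
    qed
  qed
qed

section \<open>The action of A on elements and subgroups\<close>

locale automorphism_subgroup = group G for G (structure) +
  fixes A
  assumes subgroup_A: "subgroup A (AutoGroup G)"
begin

abbreviation "orb \<equiv> element_orbit G A"

lemma orb_eq: "orb g = {a g |a. a \<in> A}"
  by (simp add: element_orbit_def orbit_def)

lemma auto_A: "a \<in> A \<Longrightarrow> a \<in> auto G"
  using subgroup.subset[OF subgroup_A] by (auto simp: AutoGroup_def)

lemma hom_A: "a \<in> A \<Longrightarrow> group_hom G G a"
  using auto_A by (simp add: group_hom_def group_hom_axioms_def auto_def)

lemma bij_A: "a \<in> A \<Longrightarrow> bij_betw a (carrier G) (carrier G)"
  using auto_A by (auto simp: auto_def Bij_def)

lemma closed_A: "a \<in> A \<Longrightarrow> x \<in> carrier G \<Longrightarrow> a x \<in> carrier G"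
  using bij_A by (auto dest: bij_betwE)

text \<open>Elements of \<open>BijGroup\<close> are extensional maps, so its unit is the identity
  restricted to the carrier; for the same reason its product is \<open>compose\<close>.\<close>

lemma id_A: "(\<lambda>x \<in> carrier G. x) \<in> A"
  using subgroup.one_closed[OF subgroup_A] by (simp add: AutoGroup_def BijGroup_def)

lemma compose_A: "a \<in> A \<Longrightarrow> b \<in> A \<Longrightarrow> compose (carrier G) a b \<in> A"
  using subgroup.m_closed[OF subgroup_A, of a b] auto_A[of a] auto_A[of b]
  by (simp add: AutoGroup_def BijGroup_def auto_def)

text \<open>Automorphisms form a subgroup of the group of bijections, so the inverse in
  \<open>AutoGroup G\<close> is the inverse there, namely \<open>inv_into\<close> on the
  carrier.\<close>

lemma inv_A: "a \<in> A \<Longrightarrow> \<exists>b \<in> A. \<forall>x \<in> carrier G. b (a x) = x"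
proof
  assume a: "a \<in> A"
  show "inv\<^bsub>AutoGroup G\<^esub> a \<in> A"
    using subgroup.m_inv_closed[OF subgroup_A a] .
  have "inv\<^bsub>AutoGroup G\<^esub> a = inv\<^bsub>BijGroup (carrier G)\<^esub> a"
    unfolding AutoGroup_def
    using group.m_inv_consistent[OF group_BijGroup subgroup_auto auto_A[OF a]] .
  also have "\<dots> = (\<lambda>x \<in> carrier G. inv_into (carrier G) a x)"
    using auto_A[OF a] by (simp add: inv_BijGroup auto_def)
  finally show "\<forall>x \<in> carrier G. (inv\<^bsub>AutoGroup G\<^esub> a) (a x) = x"
    using bij_A[OF a] closed_A[OF a] by (simp add: bij_betw_inv_into_left)
qed

lemma generate_image_A: "a \<in> A \<Longrightarrow> g \<in> carrier G \<Longrightarrow> a ` generate G {g} = generate G {a g}"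
  using group_hom.generate_img[OF hom_A, of a "{g}"] by simp

lemma minimal_image_A:
  assumes "a \<in> A" "H \<in> minimal_subgroups G p"
  shows "a ` H \<in> minimal_subgroups G p"
proof -
  have H: "subgroup H G" "card H = p"
    using assms(2) by (auto simp: minimal_subgroups_def)
  have "inj_on a H"
    using bij_A[OF assms(1)] subgroup.subset[OF H(1)] by (meson bij_betw_imp_inj_on inj_on_subset)
  then show ?thesis
    using H group_hom.subgroup_img_is_subgroup[OF hom_A[OF assms(1)]]
    by (simp add: minimal_subgroups_def card_image)
qed

lemma orb_closed: "x \<in> carrier G \<Longrightarrow> y \<in> orb x \<Longrightarrow> y \<in> carrier G"
  using closed_A by (auto simp: orb_eq)

lemma orb_refl:
  assumes "x \<in> carrier G"
  shows "x \<in> orb x"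
proof -
  have "x = (\<lambda>x \<in> carrier G. x) x"
    using assms by simp
  then show ?thesis
    unfolding orb_eq using id_A by blast
qed

lemma orb_subset: "x \<in> carrier G \<Longrightarrow> y \<in> orb x \<Longrightarrow> orb y \<subseteq> orb x"
proof
  fix z assume x: "x \<in> carrier G" and "y \<in> orb x" "z \<in> orb y"
  then obtain a b where ab: "a \<in> A" "b \<in> A" "z = b (a x)"
    by (auto simp: orb_eq)
  then have "z = compose (carrier G) b a x"
    using x by (simp add: compose_def)
  then show "z \<in> orb x"
    using compose_A ab by (auto simp: orb_eq)
qed

text \<open>An automorphism in A that undoes the one taking x to y puts x into the orbit of y, so
  \<open>orb_subset\<close> applies in both directions.\<close>

lemma orb_cong: "x \<in> carrier G \<Longrightarrow> y \<in> orb x \<Longrightarrow> orb y = orb x"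
proof (rule equalityI)
  assume x: "x \<in> carrier G" and y: "y \<in> orb x"
  then obtain a b where "a \<in> A" "y = a x" "b \<in> A" "b (a x) = x"
    using inv_A by (fastforce simp: orb_eq)
  then have "x \<in> orb y"
    unfolding orb_eq by (metis (mono_tags, lifting) mem_Collect_eq)
  then show "orb x \<subseteq> orb y"
    using orb_subset orb_closed x y by blast
qed (rule orb_subset)

end

section \<open>Minimal subgroups and their orbit representatives\<close>

locale p_group_automorphisms = automorphism_subgroup +
  fixes p :: nat and C0
  assumes prime_p: "prime p"
    and finite_G: "finite (carrier G)"
    and p_group: "\<exists>n. order G = p ^ n"
    and reps: "orbit_representatives G A (minimal_subgroups G p) C0"
begin

lemma ord_positive: "x \<in> carrier G \<Longrightarrow> ord x > 0"
  using ord_ge_1[OF finite_G] by force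

text \<open>The order of g divides that of G, so it is a power of p, and it is not 1. Hence p
  divides it, and the span of g contains an element of order p.\<close>

lemma ex_minimal_subgroup_below:
  assumes "g \<in> carrier G" "g \<noteq> \<one>"
  shows "\<exists>M \<in> minimal_subgroups G p. M \<subseteq> generate G {g}"
proof -
  obtain n where "order G = p ^ n"
    using p_group by blast
  then have "ord g dvd p ^ n"
    using ord_dvd_group_order[OF assms(1)] by simp
  then obtain k where k: "ord g = p ^ k"
    using prime_p by (auto simp: divides_primepow_nat)
  have "ord g \<noteq> 1"
    using assms ord_eq_1 by metis
  then have "p dvd ord g"
    using k by (cases k) auto
  then obtain m where m: "m \<in> generate G {g}" "ord m = p"
    using ex_prime_subgroup_of_cyclic[OF assms(1) prime_p] ord_positive[OF assms(1)] by blast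
  have g: "subgroup (generate G {g}) G"
    using assms(1) by (intro generate_is_subgroup) simp
  then have mG: "m \<in> carrier G"
    using m(1) subgroup.subset by blast
  have "generate G {m} \<in> minimal_subgroups G p"
    using mG m(2) by (auto simp: minimal_subgroups_def generate_pow_card[symmetric]
      intro!: generate_is_subgroup)
  moreover have "generate G {m} \<subseteq> generate G {g}"
    using m(1) g by (intro generate_subgroup_incl) auto
  ultimately show ?thesis by blast
qed

lemma minimal_subgroup_below_unique:
  assumes "z \<in> carrier G" "H \<in> minimal_subgroups G p" "K \<in> minimal_subgroups G p"
    "H \<subseteq> generate G {z}" "K \<subseteq> generate G {z}"
  shows "H = K"
  using subgroup_card_eq_if_subset_cyclic[OF assms(1) ord_positive[OF assms(1)], of H p K]
    assms prime_p by (auto simp: minimal_subgroups_def prime_gt_0_nat)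

lemma minimal_subgroup_eq_generate:
  assumes "H \<in> minimal_subgroups G p"
  shows "\<exists>z \<in> carrier G. z \<noteq> \<one> \<and> H = generate G {z}"
  using generate_singleton_if_prime_card[OF prime_p] assms by (auto simp: minimal_subgroups_def)

lemma C0_minimal: "H \<in> C0 \<Longrightarrow> H \<in> minimal_subgroups G p"
  using reps by (auto simp: orbit_representatives_def)

lemma ex1_representative:
  assumes "M \<in> minimal_subgroups G p"
  shows "\<exists>!H. H \<in> C0 \<and> (\<exists>a \<in> A. H = a ` M)"
proof -
  have "{a ` M |a. a \<in> A} \<in>
      orbits (AutoGroup G\<lparr>carrier := A\<rparr>) (minimal_subgroups G p) (\<lambda>a H. a ` H)"
    using assms by (auto simp: orbits_def orbit_def)
  then have "\<exists>!H. H \<in> {a ` M |a. a \<in> A} \<inter> C0"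
    by (rule reps[unfolded orbit_representatives_def, THEN conjunct2, THEN bspec])
  moreover have "H \<in> {a ` M |a. a \<in> A} \<inter> C0 \<longleftrightarrow> H \<in> C0 \<and> (\<exists>a \<in> A. H = a ` M)" for H
    by auto
  ultimately show ?thesis
    by (simp only:)
qed

text \<open>Both subgroups lie in the orbit of H, the first one through the identity, and that orbit
  has only one representative.\<close>

lemma representatives_conjugate_eq:
  assumes "H \<in> C0" "H' \<in> C0" "a \<in> A" "H' = a ` H"
  shows "H = H'"
proof -
  have "H \<subseteq> carrier G"
    using C0_minimal[OF assms(1)] by (auto simp: minimal_subgroups_def dest: subgroup.subset)
  then have "H = (\<lambda>x \<in> carrier G. x) ` H"
    by force
  then show ?thesis
    using ex1_representative[OF C0_minimal[OF assms(1)]] id_A assms by blast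
qed

section \<open>The representative attached to an orbit of elements\<close>

text \<open>The element g ranges over all of X because the minimal subgroup in the span of a given
  element need not itself be a chosen representative.\<close>

definition below :: "'a set \<Rightarrow> 'a set \<Rightarrow> bool" where
  "below H X \<longleftrightarrow> H \<in> C0 \<and> (\<exists>g \<in> X. H \<subseteq> generate G {g})"

text \<open>The automorphism that moves a minimal subgroup M of the span of x to its representative
  also moves x, within its orbit, to an element whose span contains that representative.\<close>

lemma ex_below:
  assumes "x \<in> carrier G" "x \<noteq> \<one>"
  shows "\<exists>H. below H (orb x)"
proof -
  obtain M where M: "M \<in> minimal_subgroups G p" "M \<subseteq> generate G {x}"
    using ex_minimal_subgroup_below[OF assms] by blast
  obtain H a where H: "H \<in> C0" "a \<in> A" "H = a ` M"
    using ex1_representative[OF M(1)] by blast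
  have "H \<subseteq> generate G {a x}"
    using M(2) H generate_image_A[OF H(2) assms(1)] by blast
  then show ?thesis
    using H by (auto simp: below_def orb_eq)
qed

text \<open>Automorphisms in A move both H and K into one cyclic group containing x' and y'. Their
  images coincide there by uniqueness, so H and K are conjugate under A, and conjugate
  representatives are equal.\<close>

lemma below_cyclic_eq:
  assumes x: "x \<in> carrier G" and y: "y \<in> carrier G"
    and H: "below H (orb x)" and K: "below K (orb y)"
    and x': "x' \<in> orb x" and y': "y' \<in> orb y"
    and cyc: "cyclic_group (subgroup_generated G {x', y'})"
  shows "H = K"
proof -
  have G': "x' \<in> carrier G" "y' \<in> carrier G"
    using x y x' y' orb_closed by auto
  obtain z where z: "z \<in> carrier G" "x' \<in> generate G {z}" "y' \<in> generate G {z}"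
    using cyclic_subgroup_generated_pairD[OF cyc G'] by blast
  \<comment> \<open>The element g over L and the element w' share an orbit, so some automorphism
    takes g to w' and carries L into the span of w', which lies in that of z.\<close>
  have conj: "\<exists>a \<in> A. a ` L \<subseteq> generate G {z}"
    if w: "w \<in> carrier G" "below L (orb w)" "w' \<in> orb w" "w' \<in> generate G {z}" for w w' L
  proof -
    obtain g where g: "g \<in> orb w" "L \<subseteq> generate G {g}"
      using w(2) by (auto simp: below_def)
    have "g \<in> carrier G"
      using w(1) g orb_closed by blast
    moreover have "w' \<in> orb g"
      using w(1,3) g orb_cong by blast
    ultimately obtain a where a: "a \<in> A" "w' = a g" "g \<in> carrier G"
      by (auto simp: orb_eq)
    have "a ` L \<subseteq> generate G {w'}"
      using g(2) a generate_image_A by blast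
    also have "\<dots> \<subseteq> generate G {z}"
      using w(4) z(1) by (intro generate_subgroup_incl generate_is_subgroup) auto
    finally show ?thesis using a by blast
  qed
  obtain a b where ab: "a \<in> A" "a ` H \<subseteq> generate G {z}" "b \<in> A" "b ` K \<subseteq> generate G {z}"
    using conj x y H K x' y' z by meson
  have HK: "H \<in> C0" "K \<in> C0"
    using H K by (auto simp: below_def)
  have eq: "a ` H = b ` K"
    using minimal_subgroup_below_unique[OF z(1)] minimal_image_A C0_minimal HK ab by blast
  have sub: "H \<subseteq> carrier G" "K \<subseteq> carrier G"
    using HK C0_minimal by (auto simp: minimal_subgroups_def dest!: subgroup.subset)
  obtain c where c: "c \<in> A" "\<forall>x \<in> carrier G. c (b x) = x"
    using inv_A ab by blast
  \<comment> \<open>Undoing b with c exhibits K as the image of H under the composite of a and c,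
    again a member of A.\<close>
  have "K = c ` b ` K"
    using c(2) sub(2) by (force simp: image_image)
  also have "\<dots> = c ` a ` H"
    using eq by simp
  also have "\<dots> = compose (carrier G) c a ` H"
    using sub(1) by (force simp: image_image compose_def)
  finally show ?thesis
    using representatives_conjugate_eq HK compose_A c(1) ab(1) by blast
qed

text \<open>This is the degenerate case of \<open>below_cyclic_eq\<close> where both ends are x,
  whose span is cyclic.\<close>

lemma below_unique:
  assumes "x \<in> carrier G" "below H (orb x)" "below K (orb x)"
  shows "H = K"
proof (rule below_cyclic_eq[OF assms(1,1,2,3)])
  show "x \<in> orb x" "x \<in> orb x"
    using assms(1) by (rule orb_refl)+
  show "cyclic_group (subgroup_generated G {x, x})"
    using cyclic_group_generated[of x] by simp
qed

text \<open>This is the vertex invariant whose fibres turn out to be the components; on vertices the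
  description is proper by \<open>ex_below\<close> and \<open>below_unique\<close>.\<close>

definition rep_below :: "'a set \<Rightarrow> 'a set" where
  "rep_below X = (THE H. below H X)"

lemma rep_below_eq: "x \<in> carrier G \<Longrightarrow> below H (orb x) \<Longrightarrow> rep_below (orb x) = H"
  unfolding rep_below_def by (rule the_equality) (assumption, rule below_unique)

lemma below_rep_below: "x \<in> carrier G \<Longrightarrow> x \<noteq> \<one> \<Longrightarrow> below (rep_below (orb x)) (orb x)"
  using ex_below[of x] rep_below_eq[of x] by auto

lemma below_generate:
  "x \<in> carrier G \<Longrightarrow> generate G {x} \<in> C0 \<Longrightarrow> below (generate G {x}) (orb x)"
  unfolding below_def using orb_refl by blast

section \<open>Components of the graph as fibres of the invariant\<close>

abbreviation "\<Delta> \<equiv> aut_cyclic_graph G A"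

lemma arc_rep_below:
  assumes "(u, v) \<in> parcs \<Delta>"
  shows "rep_below u = rep_below v"
proof -
  obtain x y x' y' where "u = orb x" "v = orb y" "x \<in> carrier G" "x \<noteq> \<one>" "y \<in> carrier G" "y \<noteq> \<one>"
    "x' \<in> orb x" "y' \<in> orb y" "cyclic_group (subgroup_generated G {x', y'})"
    using assms by (auto simp: aut_cyclic_graph_def)
  then show ?thesis
    using below_cyclic_eq below_rep_below by metis
qed

text \<open>Some g in the orbit v has x in its span, so x and g together generate the cyclic group
  spanned by g.\<close>

lemma arc_if_below:
  assumes x: "x \<in> carrier G" "x \<noteq> \<one>" "generate G {x} = rep_below v"
    and v: "v \<in> pverts \<Delta>" "v \<noteq> orb x"
  shows "(orb x, v) \<in> parcs \<Delta>"
proof -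
  obtain y where y: "v = orb y" "y \<in> carrier G" "y \<noteq> \<one>"
    using v(1) by (auto simp: aut_cyclic_graph_def)
  obtain g where g: "g \<in> orb y" "generate G {x} \<subseteq> generate G {g}"
    using below_rep_below[OF y(2,3)] x(3) y(1) by (auto simp: below_def)
  then have "x \<in> generate G {g}"
    by (auto intro: generate.incl)
  then have "cyclic_group (subgroup_generated G {x, g})"
    using cyclic_subgroup_generated_pairI orb_closed[OF y(2) g(1)] by blast
  then have "\<exists>x' \<in> orb x. \<exists>y' \<in> orb y. cyclic_group (subgroup_generated G {x', y'})"
    using g(1) orb_refl[OF x(1)] by blast
  then show ?thesis
    using x(1,2) v(2) y by (simp add: aut_cyclic_graph_def) blast
qed

text \<open>The orbit of a generator z of the common representative serves as a hub: it equals or is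
  adjacent to every vertex with that representative, so u and v are joined through it.\<close>

lemma reachable_if_rep_below_eq:
  assumes u: "u \<in> pverts \<Delta>" and v: "v \<in> pverts \<Delta>" and eq: "rep_below u = rep_below v"
  shows "u \<rightarrow>\<^sup>*\<^bsub>with_proj \<Delta>\<^esub> v"
proof -
  interpret D: pair_graph \<Delta>
    using finite_G by (rule pair_graph_aut_cyclic_graph)
  have "rep_below u \<in> C0"
    using u below_rep_below by (auto simp: aut_cyclic_graph_def below_def)
  then obtain z where z: "z \<in> carrier G" "z \<noteq> \<one>" "rep_below u = generate G {z}"
    using minimal_subgroup_eq_generate C0_minimal by blast
  have reach: "orb z \<rightarrow>\<^sup>*\<^bsub>with_proj \<Delta>\<^esub> w"
    if w: "w \<in> pverts \<Delta>" "rep_below w = generate G {z}" for w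
  proof (cases "w = orb z")
    case True
    then show ?thesis using w(1) by simp
  next
    case False
    then have "(orb z, w) \<in> parcs \<Delta>"
      using arc_if_below z w by simp
    then have "orb z \<rightarrow>\<^bsub>with_proj \<Delta>\<^esub> w"
      by (simp add: arcs_ends_def arc_to_ends_def)
    then show ?thesis by (rule wf_digraph.reachable_adjI[OF D.wf_digraph])
  qed
  have "u \<rightarrow>\<^sup>*\<^bsub>with_proj \<Delta>\<^esub> orb z"
    using reach[OF u] z(3) symmetric_reachable[OF D.sym_arcs] by blast
  also have "orb z \<rightarrow>\<^sup>*\<^bsub>with_proj \<Delta>\<^esub> v"
    using reach[OF v] z(3) eq by simp
  finally show ?thesis .
qed

text \<open>For surjectivity, a generator z of a representative H gives a vertex whose
  representative is H, since H is the span of z itself.\<close>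

lemma rep_below_image: "rep_below ` pverts \<Delta> = C0"
proof
  show "rep_below ` pverts \<Delta> \<subseteq> C0"
    using below_rep_below by (auto simp: aut_cyclic_graph_def below_def)
  show "C0 \<subseteq> rep_below ` pverts \<Delta>"
  proof
    fix H assume H: "H \<in> C0"
    obtain z where z: "z \<in> carrier G" "z \<noteq> \<one>" "H = generate G {z}"
      using minimal_subgroup_eq_generate C0_minimal H by blast
    then have "rep_below (orb z) = H"
      using rep_below_eq below_generate H by blast
    then show "H \<in> rep_below ` pverts \<Delta>"
      using z by (auto simp: aut_cyclic_graph_def)
  qed
qed

lemma bij_betw_components_reps:
  "bij_betw (\<lambda>K. the_elem (rep_below ` verts K)) (connected_components \<Delta>) C0"
proof -
  have "bij_betw (\<lambda>K. the_elem (rep_below ` verts K)) (connected_components \<Delta>)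
      (rep_below ` pverts \<Delta>)"
    by (rule bij_betw_connected_components(1)[where h = rep_below and D = \<Delta>])
      (fact pair_graph_aut_cyclic_graph[OF finite_G] arc_rep_below reachable_if_rep_below_eq)+
  then show ?thesis
    by (simp only: rep_below_image)
qed

lemma rep_below_component_eq:
  assumes "K \<in> connected_components \<Delta>" "u \<in> verts K" "v \<in> verts K"
  shows "rep_below u = rep_below v"
  by (rule bij_betw_connected_components(2)[where h = rep_below and D = \<Delta> and K = K])
    (fact pair_graph_aut_cyclic_graph[OF finite_G] arc_rep_below reachable_if_rep_below_eq assms)+

end

theorem theorem2:
  fixes G :: "('a, 'b) monoid_scheme" (structure)
    and p :: nat
    and A :: "('a \<Rightarrow> 'a) set"
    and C0 :: "'a set set"
  assumes "prime p"
    and "group G"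
    and "finite (carrier G)"
    and "\<exists>n. order G = p ^ n"
    and "subgroup A (AutoGroup G)"
    and "orbit_representatives G A (minimal_subgroups G p) C0"
  shows "(\<exists>f. bij_betw f (connected_components (aut_cyclic_graph G A)) C0) \<and>
    (\<forall>x \<in> carrier G. x \<noteq> \<one> \<and> generate G {x} \<in> C0 \<longrightarrow>
      (\<forall>K \<in> connected_components (aut_cyclic_graph G A). element_orbit G A x \<in> verts K \<longrightarrow>
        (\<forall>v \<in> verts K. v \<noteq> element_orbit G A x \<longrightarrow>
          (element_orbit G A x, v) \<in> parcs (aut_cyclic_graph G A))))"
proof -
  interpret p_group_automorphisms G A p C0
    by (intro p_group_automorphisms.intro automorphism_subgroup.intro
      automorphism_subgroup_axioms.intro p_group_automorphisms_axioms.intro) (fact assms)+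
  interpret D: pair_graph \<Delta>
    using finite_G by (rule pair_graph_aut_cyclic_graph)
  have "(orb x, v) \<in> parcs \<Delta>"
    if x: "x \<in> carrier G" "x \<noteq> \<one>" "generate G {x} \<in> C0"
      and K: "K \<in> connected_components \<Delta>" "orb x \<in> verts K" "v \<in> verts K" "v \<noteq> orb x" for x K v
  proof -
    \<comment> \<open>The invariant is constant on K, and its value at the orbit of x is the span of
      x, which is a chosen representative. So the orbit of x is the hub of K.\<close>
    have "rep_below v = generate G {x}"
      using rep_below_component_eq[OF K(1,3,2)] rep_below_eq below_generate x by simp
    moreover have "v \<in> pverts \<Delta>"
      using K by (auto simp: connected_components_def D.max_subgraph_def subgraph_def)
    ultimately show ?thesis
      using arc_if_below x K(4) by simp
  qed
  then show ?thesis
    using bij_betw_components_reps by blast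
qed

end
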